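(* Let $G=(V,E)$ be a directed graph with positive real capacities, a designated source vertex $s$ and a designated sink vertex $t$. Let $\mathcal{E}$ be a set of vital edges of $G$, let $e\in\mathcal{E}$, and let $C(e)$ be a mincut for $e$. Then $\mathcal{E}$ is partitioned into the three subsets: (i) the edges of $\mathcal{E}$ contributing to $C(e)$, (ii) the edges of $\mathcal{E}$ with both endpoints in $C(e)$, and (iii) the edges of $\mathcal{E}$ with both endpoints in $V\setminus C(e)$.
   Context: An $(s,t)$-cut is a set $C\subset V$ with $s\in C$, $t\notin C$; an edge $(x,y)$ contributes to $C$ if $x\in C$, $y\notin C$; $c(C)$ is the total capacity of contributing edges. An edge is vital if its removal strictly decreases the minimum $(s,t)$-cut capacity. A mincut for edge $e$ is an $(s,t)$-cut to which $e$ contributes of minimum capacity among all $(s,t)$-cuts to which $e$ contributes. *)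

theory Defs
  imports Complex_Main "Graph_Theory.Digraph"
begin

(* Arcs are abstract objects with a tail and a head, so parallel arcs are allowed;
   a graph whose edges are ordered pairs is the instance tail = fst, head = snd. *)
locale st_network = fin_digraph G
  for G :: "('v, 'e) pre_digraph" +
  fixes c :: "'e \<Rightarrow> real" and s t :: 'v
  assumes capacity_pos: "\<And>e. e \<in> arcs G \<Longrightarrow> 0 < c e"
    and source_in_verts: "s \<in> verts G"
    and sink_in_verts: "t \<in> verts G"
    and source_neq_sink: "s \<noteq> t"

(* The notions below take the graph as an argument because vitality compares G
   with G minus an arc. *)

definition st_cuts :: "('v, 'e) pre_digraph \<Rightarrow> 'v \<Rightarrow> 'v \<Rightarrow> 'v set set" where
  "st_cuts G s t = {C. C \<subseteq> verts G \<and> s \<in> C \<and> t \<notin> C}"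

definition contributes :: "('v, 'e) pre_digraph \<Rightarrow> 'v set \<Rightarrow> 'e \<Rightarrow> bool" where
  "contributes G C e \<longleftrightarrow> e \<in> arcs G \<and> tail G e \<in> C \<and> head G e \<notin> C"

definition cut_capacity :: "('v, 'e) pre_digraph \<Rightarrow> ('e \<Rightarrow> real) \<Rightarrow> 'v set \<Rightarrow> real" where
  "cut_capacity G c C = (\<Sum>e | contributes G C e. c e)"

(* In an st_network the set of (s,t)-cuts is finite and contains {s}, so this
   is a genuine minimum. *)
definition min_cut_capacity ::
    "('v, 'e) pre_digraph \<Rightarrow> ('e \<Rightarrow> real) \<Rightarrow> 'v \<Rightarrow> 'v \<Rightarrow> real" where
  "min_cut_capacity G c s t = Min (cut_capacity G c ` st_cuts G s t)"

definition vital ::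
    "('v, 'e) pre_digraph \<Rightarrow> ('e \<Rightarrow> real) \<Rightarrow> 'v \<Rightarrow> 'v \<Rightarrow> 'e \<Rightarrow> bool" where
  "vital G c s t e \<longleftrightarrow>
     e \<in> arcs G \<and>
     min_cut_capacity (pre_digraph.del_arc G e) c s t < min_cut_capacity G c s t"

definition mincut_for ::
    "('v, 'e) pre_digraph \<Rightarrow> ('e \<Rightarrow> real) \<Rightarrow> 'v \<Rightarrow> 'v \<Rightarrow> 'e \<Rightarrow> 'v set \<Rightarrow> bool" where
  "mincut_for G c s t e C \<longleftrightarrow>
     C \<in> st_cuts G s t \<and> contributes G C e \<and>
     (\<forall>C' \<in> st_cuts G s t. contributes G C' e \<longrightarrow> cut_capacity G c C \<le> cut_capacity G c C')"

end

theory Submission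
  imports Defs
begin

text \<open>
  If a vital arc \<open>f\<close> entered \<open>C = C(e)\<close>, take an (s,t)-cut \<open>D\<close> to which \<open>f\<close> contributes and
  whose capacity is less than \<open>\<lambda> + c(f)\<close>, where \<open>\<lambda>\<close> is the minimum cut capacity. Uncrossing
  \<open>C\<close> and \<open>D\<close> gains at least \<open>c(f)\<close>, since \<open>f\<close> runs from \<open>D - C\<close> to \<open>C - D\<close>. Hence the
  capacities of \<open>C \<inter> D\<close> and \<open>C \<union> D\<close> add up to less than \<open>c(C) + \<lambda>\<close>. By minimality of \<open>C\<close>, the
  arc \<open>e\<close> then contributes to neither of these cuts, so it runs from \<open>C - D\<close> to \<open>D - C\<close> and
  uncrossing gains \<open>c(e)\<close> as well; since \<open>c(C) < \<lambda> + c(e)\<close> by vitality of \<open>e\<close>, the two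
  capacities add up to less than \<open>2\<lambda>\<close>, which is impossible.
\<close>

context st_network
begin

lemma finite_st_cuts: "finite (st_cuts G s t)"
  by (rule finite_subset[of _ "Pow (verts G)"]) (auto simp: st_cuts_def)

lemma source_cut: "{s} \<in> st_cuts G s t"
  using source_in_verts source_neq_sink by (auto simp: st_cuts_def)

lemma min_cut_capacity_le:
  "D \<in> st_cuts G s t \<Longrightarrow> min_cut_capacity G c s t \<le> cut_capacity G c D"
  unfolding min_cut_capacity_def using finite_st_cuts by simp

lemma cut_capacity_sum_arcs:
  "cut_capacity G c D = (\<Sum>a\<in>arcs G. if contributes G D a then c a else 0)"
proof -
  have "{a. contributes G D a} = {a \<in> arcs G. contributes G D a}"
    by (auto simp: contributes_def)
  then show ?thesis
    by (simp add: cut_capacity_def sum.inter_filter)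
qed

text \<open>Checked arc by arc: an arc between \<open>C - D\<close> and \<open>D - C\<close>
  contributes to exactly one of \<open>C\<close>, \<open>D\<close> and to neither
  \<open>C \<inter> D\<close> nor \<open>C \<union> D\<close>; all others count equally on both
  sides.\<close>

lemma cut_capacity_Int_Un:
  "cut_capacity G c (C \<inter> D) + cut_capacity G c (C \<union> D)
     + sum c {a \<in> arcs G. tail G a \<in> C - D \<and> head G a \<in> D - C}
     + sum c {a \<in> arcs G. tail G a \<in> D - C \<and> head G a \<in> C - D}
   = cut_capacity G c C + cut_capacity G c D"
  unfolding cut_capacity_sum_arcs sum.inter_filter[OF finite_arcs] sum.distrib[symmetric]
  by (rule sum.cong) (auto simp: contributes_def)

lemma cut_capacity_del_arc:
  "cut_capacity (del_arc f) c D =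
     (if contributes G D f then cut_capacity G c D - c f else cut_capacity G c D)"
proof -
  have "{a. contributes G D a} \<subseteq> arcs G"
    by (auto simp: contributes_def)
  then have "finite {a. contributes G D a}"
    by (rule finite_subset) simp
  moreover have "{a. contributes (del_arc f) D a} = {a. contributes G D a} - {f}"
    by (auto simp: contributes_def del_arc_def)
  ultimately show ?thesis
    by (simp add: cut_capacity_def sum_diff1)
qed

text \<open>Take \<open>D\<close> minimum after deleting \<open>f\<close>. If \<open>f\<close> did
  not contribute to \<open>D\<close>, deletion would leave its capacity unchanged, hence not below
  the minimum of \<open>G\<close>.\<close>

lemma vital_obtains_cut:
  assumes "vital G c s t f"
  obtains D where "D \<in> st_cuts G s t" "contributes G D f"
    "cut_capacity G c D < min_cut_capacity G c s t + c f"
proof -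
  have "st_cuts (del_arc f) s t = st_cuts G s t"
    by (simp add: st_cuts_def del_arc_def)
  then have "min_cut_capacity (del_arc f) c s t \<in> cut_capacity (del_arc f) c ` st_cuts G s t"
    unfolding min_cut_capacity_def using finite_st_cuts source_cut by (metis Min_in empty_iff finite_imageI image_is_empty)
  then obtain D where D: "D \<in> st_cuts G s t"
    and "cut_capacity (del_arc f) c D < min_cut_capacity G c s t"
    using assms by (auto simp: vital_def)
  with min_cut_capacity_le[OF D] that show thesis
    by (auto simp: cut_capacity_del_arc split: if_splits)
qed

lemma vital_not_entering_mincut:
  assumes e: "vital G c s t e" and C: "mincut_for G c s t e C" and f: "vital G c s t f"
  shows "\<not> (tail G f \<notin> C \<and> head G f \<in> C)"
proof
  assume enters: "tail G f \<notin> C \<and> head G f \<in> C"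
  let ?l = "min_cut_capacity G c s t"
  obtain D where D: "D \<in> st_cuts G s t" "contributes G D f" "cut_capacity G c D < ?l + c f"
    using vital_obtains_cut[OF f] .
  obtain D' where "D' \<in> st_cuts G s t" "contributes G D' e" "cut_capacity G c D' < ?l + c e"
    using vital_obtains_cut[OF e] .
  with C have C_less: "cut_capacity G c C < ?l + c e"
    by (force simp: mincut_for_def)
  have cuts: "C \<inter> D \<in> st_cuts G s t" "C \<union> D \<in> st_cuts G s t"
    using C D by (auto simp: mincut_for_def st_cuts_def)
  note ge = cuts[THEN min_cut_capacity_le]
  have gain: "c a \<le> sum c {a \<in> arcs G. tail G a \<in> A \<and> head G a \<in> B}"
    if "a \<in> arcs G" "tail G a \<in> A" "head G a \<in> B" for a A B
    using that by (intro member_le_sum) (auto intro: less_imp_le capacity_pos)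
  have f_gain: "c f \<le> sum c {a \<in> arcs G. tail G a \<in> D - C \<and> head G a \<in> C - D}"
    using enters D by (intro gain) (auto simp: contributes_def)
  have "0 \<le> sum c {a \<in> arcs G. tail G a \<in> C - D \<and> head G a \<in> D - C}"
    by (intro sum_nonneg) (auto intro: less_imp_le capacity_pos)
  with f_gain D cut_capacity_Int_Un[of C D]
  have "cut_capacity G c (C \<inter> D) + cut_capacity G c (C \<union> D) < cut_capacity G c C + ?l"
    by linarith
  \<comment> \<open>Each of the two capacities is at least \<open>?l\<close>, which bounds the
    other.\<close>
  with ge have "cut_capacity G c (C \<inter> D) < cut_capacity G c C"
    "cut_capacity G c (C \<union> D) < cut_capacity G c C"
    by linarith+
  with C cuts have "\<not> contributes G (C \<inter> D) e" "\<not> contributes G (C \<union> D) e"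
    by (auto simp: mincut_for_def not_le[symmetric])
  \<comment> \<open>As \<open>e\<close> leaves \<open>C\<close>, missing \<open>C \<inter> D\<close>
    puts its tail outside \<open>D\<close>, and missing \<open>C \<union> D\<close> puts its head in
    \<open>D\<close>.\<close>
  with C have "c e \<le> sum c {a \<in> arcs G. tail G a \<in> C - D \<and> head G a \<in> D - C}"
    by (intro gain) (auto simp: mincut_for_def contributes_def)
  with f_gain D C_less ge cut_capacity_Int_Un[of C D] show False
    by linarith
qed

end

theorem theorem14:
  fixes G :: "('v, 'e) pre_digraph" and c :: "'e \<Rightarrow> real" and s t :: 'v
    and \<E> :: "'e set" and e :: 'e and C :: "'v set"
  assumes "st_network G c s t"
    and "\<forall>f\<in>\<E>. vital G c s t f"
    and "e \<in> \<E>"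
    and "mincut_for G c s t e C"
  shows "let E1 = {f \<in> \<E>. contributes G C f};
             E2 = {f \<in> \<E>. tail G f \<in> C \<and> head G f \<in> C};
             E3 = {f \<in> \<E>. tail G f \<in> verts G - C \<and> head G f \<in> verts G - C}
         in \<E> = E1 \<union> E2 \<union> E3 \<and> E1 \<inter> E2 = {} \<and> E1 \<inter> E3 = {} \<and> E2 \<inter> E3 = {}"
proof -
  interpret st_network G c s t by fact
  have "vital G c s t e"
    using assms by blast
  \<comment> \<open>Entering \<open>C\<close> is the only position of an arc outside the three
    classes.\<close>
  with assms have "\<not> (tail G f \<notin> C \<and> head G f \<in> C)" if "f \<in> \<E>" for f
    using that vital_not_entering_mincut by blast
  moreover have "f \<in> arcs G" "tail G f \<in> verts G" "head G f \<in> verts G" if "f \<in> \<E>" for f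
    using that assms by (auto simp: vital_def)
  ultimately show ?thesis
    by (auto simp: Let_def contributes_def)
qed

end
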